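(* (a) There is an irrational number $\alpha$ and an admissible test function $f$ on $\mathbb{R}^5$ such that $$R^{(5)}(N,\alpha,f) \gg N^{1/4}(\log N)^{-5} \quad \text{as } N\to\infty.$$ (b) For every $\sigma > 23/8$ there is a real number $\alpha$ of type $\sigma$ and an admissible test function $f$ on $\mathbb{R}^5$ such that $$\limsup_{N\to\infty} R^{(5)}(N,\alpha,f) = \infty.$$
   Context: A real number $\alpha$ is of type $K$ if there is $c_\alpha>0$ such that $|\alpha - a/q| \ge c_\alpha q^{-K}$ for all relatively prime integers $a$ and $q$ (with $q\ge1$). An admissible test function is a function $f(x_1,\dots,x_m)$ on $\mathbb{R}^m$ which is symmetric in $(x_1,\dots,x_m)$, satisfies $f(x+(t,\dots,t))=f(x)$ for all $t\in\mathbb{R}$, and is compactly supported modulo the diagonal. For $N\ge1$, let $0\le\beta_1\le\cdots\le\beta_N<1$ be the fractional parts $\{n^2\alpha\}$, $1\le n\le N$, in increasing order, and $$R^{(m)}(N,\alpha,f) := \frac1N\sum_{1\le j_1<\cdots<j_m\le N} f\big(N(\beta_{j_1},\dots,\beta_{j_m})\big).$$ *)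

theory Defs
  imports "HOL-Analysis.Analysis" "HOL-Library.Numeral_Type"
begin

definition of_type :: "real \<Rightarrow> real \<Rightarrow> bool" where
  "of_type K \<alpha> \<longleftrightarrow>
     (\<exists>c>0. \<forall>a q :: int. q \<ge> 1 \<and> coprime a q \<longrightarrow>
        \<bar>\<alpha> - of_int a / of_int q\<bar> \<ge> c * of_int q powr (- K))"

(* The last clause says that the function induced by f on the quotient of R^m by the
   diagonal line has compact support: the support is contained in the image of a compact set.
   Continuity is the usual regularity convention for test functions. It cannot be dropped:
   unbounded, nowhere continuous f satisfying the other three clauses make the correlations
   below arbitrarily large for every irrational \<alpha>. *)
definition admissible :: "(real ^ 'm \<Rightarrow> real) \<Rightarrow> bool" where
  "admissible f \<longleftrightarrow>
     continuous_on UNIV f \<and>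
     (\<forall>p x. bij p \<longrightarrow> f (\<chi> i. x $ p i) = f x) \<and>
     (\<forall>t x. f (x + (\<chi> i. t)) = f x) \<and>
     (\<exists>K. compact K \<and> (\<forall>x. f x \<noteq> 0 \<longrightarrow> (\<exists>t. x + (\<chi> i. t) \<in> K)))"

(* Lists are indexed from 0, so the j-th smallest fractional part has index j - 1;
   meaningful for 1 \<le> j \<le> N. *)
definition ordered_frac :: "nat \<Rightarrow> real \<Rightarrow> nat \<Rightarrow> real" where
  "ordered_frac N \<alpha> j = sort (map (\<lambda>n. frac ((real n)\<^sup>2 * \<alpha>)) [1..<Suc N]) ! (j - 1)"

(* The tuples j_1 < ... < j_m are the strictly increasing maps from the linearly
   ordered index type of R^m. *)
definition correlation ::
  "nat \<Rightarrow> real \<Rightarrow> (real ^ 'm::{finite,linorder} \<Rightarrow> real) \<Rightarrow> real" where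
  "correlation N \<alpha> f =
     1 / real N * (\<Sum>j | strict_mono j \<and> range j \<subseteq> {1..N}.
                     f (real N *\<^sub>R (\<chi> i::'m. ordered_frac N \<alpha> (j i))))"

end

theory Submission imports Defs begin

text \<open>If \<open>\<alpha>\<close> is very close to \<open>a / u\<^sup>2\<close>, the numbers \<open>n = k u\<close> with \<open>k \<le> K\<close> have all their
  fractional parts \<open>{n\<^sup>2 \<alpha>}\<close> in one window of length \<open>1 / N\<close>, provided that \<open>K u \<le> N\<close> and
  \<open>K\<^sup>2 \<parallel>u\<^sup>2 \<alpha>\<parallel> \<le> 1 / N\<close>; the \<open>5\<close>-tuples from this window contribute about \<open>K\<^sup>5 / N\<close>.

  For (a), the recursion \<open>u'' = u + u'\<^sup>2\<close> makes all \<open>u\<^sup>2\<close> denominators of consecutive convergents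
  of one \<open>\<alpha>\<close>, so \<open>\<parallel>u\<^sup>2 \<alpha>\<parallel>\<close> is about \<open>1 / u'\<^sup>2\<close>. Given \<open>N\<close>, take \<open>u \<le> N\<^bsup>3/4\<^esup> < u'\<close>: then \<open>K\<close> of
  order \<open>N\<^bsup>1/4\<^esup>\<close> is allowed, which gives \<open>N\<^bsup>1/4\<^esup>\<close> without logarithms.

  For (b), take \<open>\<alpha> = (\<Sum>j. 1 / Q\<^sub>j)\<close> with square \<open>Q\<^sub>j\<close> and \<open>Q\<^sub>j\<^sub>+\<^sub>1 = Q\<^sub>j\<^sup>2\<close>. With \<open>u\<^sup>2 = Q\<^sub>j\<close> and \<open>K\<close> of
  order \<open>u\<^bsup>1/3\<^esup>\<close> the correlation is of order \<open>K\<close>. This \<open>\<alpha>\<close> has type \<open>5/2 < 23/8\<close>.\<close>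

section \<open>Lower bounds for correlations from clusters\<close>

text \<open>Summing over all ordered pairs gives symmetry and invariance under diagonal shifts. The
  constant exceeds by 1 the largest possible sum when all differences are at most 1, so the function
  is at least 1 on clusters.\<close>

definition spread_test :: "real ^ 'm \<Rightarrow> real" where
  "spread_test x =
     max 0 (real (CARD('m) * CARD('m) + 1) - (\<Sum>i\<in>UNIV. \<Sum>j\<in>UNIV. \<bar>x $ i - x $ j\<bar>))"

lemma spread_test_nonneg: "0 \<le> spread_test x"
  by (simp add: spread_test_def)

lemma spread_test_ge_1:
  fixes x :: "real ^ 'm"
  assumes "\<And>i j. \<bar>x $ i - x $ j\<bar> \<le> 1"
  shows "1 \<le> spread_test x"
proof -
  have "(\<Sum>i\<in>UNIV. \<Sum>j\<in>UNIV. \<bar>x $ i - x $ j\<bar>) \<le> (\<Sum>i\<in>(UNIV::'m set). \<Sum>j\<in>(UNIV::'m set). 1)"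
    using assms by (intro sum_mono)
  then show ?thesis by (simp add: spread_test_def)
qed

lemma admissible_spread_test: "admissible (spread_test :: real ^ 'm \<Rightarrow> real)"
proof -
  define C where "C = real (CARD('m) * CARD('m) + 1)"
  have "continuous_on UNIV (spread_test :: real ^ 'm \<Rightarrow> real)"
    unfolding spread_test_def by (intro continuous_intros)
  moreover have "spread_test (\<chi> i. x $ p i) = spread_test x" if "bij p" for p :: "'m \<Rightarrow> 'm" and x :: "real ^ 'm"
  proof -
    have "(\<Sum>i\<in>UNIV. \<Sum>j\<in>UNIV. \<bar>x $ p i - x $ p j\<bar>) = (\<Sum>i\<in>UNIV. \<Sum>j\<in>UNIV. \<bar>x $ p i - x $ j\<bar>)"
      using that by (intro sum.cong refl sum.reindex_bij_betw)
    also have "\<dots> = (\<Sum>i\<in>UNIV. \<Sum>j\<in>UNIV. \<bar>x $ i - x $ j\<bar>)"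
      using that by (rule sum.reindex_bij_betw)
    finally show ?thesis by (simp add: spread_test_def)
  qed
  moreover have "spread_test (x + (\<chi> i. t)) = spread_test x" for t and x :: "real ^ 'm"
    by (simp add: spread_test_def)
  moreover have "\<exists>t. x + (\<chi> i. t) \<in> cbox (\<chi> i. - C) (\<chi> i. C)"
    if "spread_test x \<noteq> 0" for x :: "real ^ 'm"
  proof -
    \<comment> \<open>An arbitrary coordinate: translating it to 0 moves \<open>x\<close> into the
      box.\<close>
    obtain k :: 'm where True by blast
    have "\<bar>x $ i - x $ k\<bar> \<le> C" for i
    proof -
      have "\<bar>x $ i - x $ k\<bar> \<le> (\<Sum>j\<in>UNIV. \<bar>x $ i - x $ j\<bar>)"
        by (rule member_le_sum) auto
      also have "\<dots> \<le> (\<Sum>i\<in>UNIV. \<Sum>j\<in>UNIV. \<bar>x $ i - x $ j\<bar>)"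
        by (rule member_le_sum[where f = "\<lambda>i. \<Sum>j\<in>UNIV. \<bar>x $ i - x $ j\<bar>"])
           (auto intro: sum_nonneg)
      also have "\<dots> \<le> C"
        using that by (simp add: spread_test_def C_def max_def split: if_splits)
      finally show ?thesis .
    qed
    then have "- C \<le> x $ i - x $ k \<and> x $ i - x $ k \<le> C" for i
      by (metis abs_le_iff minus_le_iff)
    then show ?thesis
      by (intro exI[of _ "- x $ k"]) (simp add: mem_box_cart)
  qed
  ultimately show ?thesis
    unfolding admissible_def by (blast intro: compact_cbox)
qed

section \<open>Counting increasing tuples and sorted fractional parts\<close>

lemma card_strict_mono_ge:
  fixes J :: "nat set"
  assumes "finite J" and "CARD('m) * L \<le> card J"
  shows "L ^ CARD('m) \<le> card {j :: 'm::{finite,linorder} \<Rightarrow> nat. strict_mono j \<and> range j \<subseteq> J}"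
proof -
  define xs where "xs = sorted_list_of_set J"
  \<comment> \<open>The rank of \<open>i\<close> in the abstract linear order. The increasing list
    of \<open>J\<close> is cut into blocks of length \<open>L\<close>, and \<open>F x\<close> takes
    entry \<open>x i\<close> of block number \<open>idx i\<close>; any such choice is
    increasing.\<close>
  define idx where "idx i = card {k. k < i}" for i :: 'm
  define F where "F x = (\<lambda>i. xs ! (idx i * L + x i))" for x :: "'m \<Rightarrow> nat"
  let ?X = "PiE UNIV (\<lambda>_::'m. {..<L})"
  have len: "length xs = card J" and set: "set xs = J"
    using assms by (auto simp: xs_def)
  have sorted: "sorted_wrt (<) xs"
    by (simp add: xs_def)
  have idx_less: "idx i < idx k" if "i < k" for i k
    unfolding idx_def using that by (intro psubset_card_mono) auto
  have idx_bound: "idx i < CARD('m)" for i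
    unfolding idx_def by (intro psubset_card_mono) auto
  have pos_bound: "idx i * L + x i < length xs" if "x \<in> ?X" for x i
  proof -
    have "idx i * L + x i < Suc (idx i) * L"
      using that by (auto simp: PiE_iff)
    also have "\<dots> \<le> CARD('m) * L"
      using idx_bound[of i] by (intro mult_right_mono) auto
    finally show ?thesis using assms len by linarith
  qed
  have pos_less: "idx i * L + x i < idx k * L + x k" if "x \<in> ?X" "i < k" for x i k
  proof -
    have "idx i * L + x i < Suc (idx i) * L"
      using that by (auto simp: PiE_iff)
    also have "\<dots> \<le> idx k * L"
      using idx_less[OF that(2)] by (intro mult_right_mono) auto
    finally show ?thesis by linarith
  qed
  have inj: "inj_on F ?X"
  proof (rule inj_onI, rule ext)
    fix x y i assume xy: "x \<in> ?X" "y \<in> ?X" "F x = F y"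
    then have "xs ! (idx i * L + x i) = xs ! (idx i * L + y i)"
      unfolding F_def by metis
    moreover have "distinct xs" by (simp add: xs_def)
    ultimately show "x i = y i"
      using pos_bound xy by (metis add_left_cancel nth_eq_iff_index_eq)
  qed
  have sub: "F ` ?X \<subseteq> {j. strict_mono j \<and> range j \<subseteq> J}"
  proof clarify
    fix x assume x: "x \<in> ?X"
    have "strict_mono (F x)"
      unfolding F_def using sorted pos_bound[OF x] pos_less[OF x]
      by (intro strict_monoI) (metis sorted_wrt_nth_less)
    moreover have "range (F x) \<subseteq> J"
      unfolding F_def using pos_bound[OF x] set by auto
    ultimately show "strict_mono (F x) \<and> range (F x) \<subseteq> J" by simp
  qed
  have "finite {j :: 'm \<Rightarrow> nat. strict_mono j \<and> range j \<subseteq> J}"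
    by (rule finite_subset[of _ "PiE UNIV (\<lambda>_. J)"]) (auto intro!: finite_PiE assms)
  from card_mono[OF this sub] inj show ?thesis
    by (simp add: card_image card_PiE)
qed

text \<open>Sorting only permutes the list of fractional parts, multiplicities included, so a count
  over \<open>n\<close> becomes a count over ranks.\<close>

lemma card_ordered_frac:
  "card {j \<in> {1..N}. P (ordered_frac N \<alpha> j)} =
   card {n \<in> {1..N}. P (frac ((real n)\<^sup>2 * \<alpha>))}"
proof -
  define ys where "ys = map (\<lambda>n. frac ((real n)\<^sup>2 * \<alpha>)) [1..<Suc N]"
  have "card {j \<in> {1..N}. P (ordered_frac N \<alpha> j)} = card {i. i < length (sort ys) \<and> P (sort ys ! i)}"
    by (rule bij_betw_same_card[where f = "\<lambda>j. j - 1"],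
        rule bij_betw_byWitness[where f' = Suc])
       (auto simp: ordered_frac_def ys_def)
  also have "\<dots> = length (filter P (sort ys))"
    by (simp add: length_filter_conv_card)
  also have "\<dots> = length (filter P ys)"
    by (metis mset_filter mset_sort size_mset)
  also have "\<dots> = length (filter (\<lambda>n. P (frac ((real n)\<^sup>2 * \<alpha>))) [1..<Suc N])"
    by (simp add: ys_def filter_map o_def del: upt_Suc)
  also have "\<dots> = card (set (filter (\<lambda>n. P (frac ((real n)\<^sup>2 * \<alpha>))) [1..<Suc N]))"
    by (rule distinct_card[symmetric]) (simp del: upt_Suc)
  also have "set (filter (\<lambda>n. P (frac ((real n)\<^sup>2 * \<alpha>))) [1..<Suc N]) =
      {n \<in> {1..N}. P (frac ((real n)\<^sup>2 * \<alpha>))}"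
    by (auto simp del: upt_Suc)
  finally show ?thesis .
qed

text \<open>If \<open>u\<^sup>2 \<alpha>\<close> is very close to an integer, the multiples \<open>k u\<close> with small \<open>k\<close> all
  have \<open>{(k u)\<^sup>2 \<alpha>}\<close> on the same side of \<open>0\<close> modulo \<open>1\<close>, hence in one window of length \<open>1 / N\<close>.\<close>

lemma correlation_cluster:
  fixes f :: "real ^ 'm::{finite,linorder} \<Rightarrow> real" and p :: int
  assumes nonneg: "\<And>x. 0 \<le> f x"
    and ge_1: "\<And>x. (\<And>i j. \<bar>x $ i - x $ j\<bar> \<le> 1) \<Longrightarrow> 1 \<le> f x"
    and "N \<ge> 2" "u \<ge> 1"
    and KN: "CARD('m) * L * u \<le> N"
    and close: "(real (CARD('m) * L))\<^sup>2 * \<bar>(real u)\<^sup>2 * \<alpha> - p\<bar> \<le> 1 / N"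
  shows "real L ^ CARD('m) / N \<le> correlation N \<alpha> f"
proof -
  define K where "K = CARD('m) * L"
  define \<epsilon> where "\<epsilon> = (real u)\<^sup>2 * \<alpha> - p"
  \<comment> \<open>For negative \<epsilon> the fractional parts wrap around and gather just below
    1.\<close>
  define y where "y = (if \<epsilon> \<ge> 0 then 0 else 1 - 1 / real N)"
  define J where "J = {j \<in> {1..N}. ordered_frac N \<alpha> j \<in> {y..y + 1 / N}}"
  have frac_in: "frac ((real (k * u))\<^sup>2 * \<alpha>) \<in> {y..y + 1 / N}" if k: "k \<in> {1..K}" for k
  proof -
    have "(real (k * u))\<^sup>2 * \<alpha> = of_int (int k ^ 2 * p) + (real k)\<^sup>2 * \<epsilon>"
      by (simp add: \<epsilon>_def algebra_simps power_mult_distrib)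
    then have *: "frac ((real (k * u))\<^sup>2 * \<alpha>) = frac ((real k)\<^sup>2 * \<epsilon>)"
      by (simp add: frac_def)
    have "(real k)\<^sup>2 * \<bar>\<epsilon>\<bar> \<le> (real K)\<^sup>2 * \<bar>\<epsilon>\<bar>"
      using k by (intro mult_right_mono power_mono) auto
    then have bound: "(real k)\<^sup>2 * \<bar>\<epsilon>\<bar> \<le> 1 / N"
      using close by (simp add: K_def \<epsilon>_def)
    \<comment> \<open>Keeps \<open>k^2\<close> \<epsilon> strictly between -1 and 1, so its
      fractional part is itself or itself plus 1.\<close>
    have N1: "1 / real N \<le> 1 / 2" using \<open>N \<ge> 2\<close> by (simp add: field_simps)
    show ?thesis
    proof (cases "\<epsilon> \<ge> 0")
      case True
      then have "frac ((real k)\<^sup>2 * \<epsilon>) = (real k)\<^sup>2 * \<epsilon>"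
        using bound N1 by (subst frac_eq) auto
      then show ?thesis using True bound by (simp add: *[unfolded of_nat_mult] y_def)
    next
      case False
      then have neg: "(real k)\<^sup>2 * \<epsilon> < 0" using k by (simp add: mult_pos_neg)
      have "(real k)\<^sup>2 * \<epsilon> \<ge> - (1 / N)" using bound False by (simp add: minus_le_iff)
      then have "frac ((real k)\<^sup>2 * \<epsilon>) = (real k)\<^sup>2 * \<epsilon> + 1"
        using neg N1 frac_unique_iff[of "(real k)\<^sup>2 * \<epsilon>" "(real k)\<^sup>2 * \<epsilon> + 1"] by auto
      then show ?thesis
        using False neg \<open>(real k)\<^sup>2 * \<epsilon> \<ge> - (1 / N)\<close> by (simp add: *[unfolded of_nat_mult] y_def)
    qed
  qed
  have finJ: "finite J" by (simp add: J_def)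
  \<comment> \<open>Distinct \<open>k\<close> give distinct \<open>n = k u\<close>, so the window
    holds at least \<open>K\<close> ranks even if some fractional parts coincide.\<close>
  have "(\<lambda>k. k * u) ` {1..K} \<subseteq> {n \<in> {1..N}. frac ((real n)\<^sup>2 * \<alpha>) \<in> {y..y + 1 / N}}"
  proof (rule image_subsetI)
    fix k assume k: "k \<in> {1..K}"
    then have "k * u \<le> K * u" by (intro mult_right_mono) auto
    also have "K * u \<le> N" using KN by (simp add: K_def)
    finally have "k * u \<in> {1..N}" using k \<open>u \<ge> 1\<close> by simp
    with frac_in[OF k] show "k * u \<in> {n \<in> {1..N}. frac ((real n)\<^sup>2 * \<alpha>) \<in> {y..y + 1 / N}}"
      by blast
  qed
  moreover have "inj_on (\<lambda>k. k * u) {1..K}"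
    using \<open>u \<ge> 1\<close> by (auto simp: inj_on_def)
  ultimately have "card {1..K} \<le> card {n \<in> {1..N}. frac ((real n)\<^sup>2 * \<alpha>) \<in> {y..y + 1 / N}}"
    by (intro card_inj_on_le) auto
  also have "\<dots> = card J"
    unfolding J_def by (rule card_ordered_frac[symmetric])
  finally have "card {1..K} \<le> card J" .
  then have "L ^ CARD('m) \<le> card {j :: 'm \<Rightarrow> nat. strict_mono j \<and> range j \<subseteq> J}"
    using finJ by (intro card_strict_mono_ge) (simp_all add: K_def)
  then have "real L ^ CARD('m) \<le> (\<Sum>j | strict_mono (j :: 'm \<Rightarrow> nat) \<and> range j \<subseteq> J. 1)"
    by (simp flip: of_nat_power)
  also have "\<dots> \<le> (\<Sum>j | strict_mono j \<and> range j \<subseteq> J.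
      f (real N *\<^sub>R (\<chi> i::'m. ordered_frac N \<alpha> (j i))))"
  proof (rule sum_mono, rule ge_1)
    fix j :: "'m \<Rightarrow> nat" and i k
    assume "j \<in> {j. strict_mono j \<and> range j \<subseteq> J}"
    then have "ordered_frac N \<alpha> (j i) \<in> {y..y + 1 / N}" "ordered_frac N \<alpha> (j k) \<in> {y..y + 1 / N}"
      by (auto simp: J_def)
    then have "\<bar>ordered_frac N \<alpha> (j i) - ordered_frac N \<alpha> (j k)\<bar> \<le> 1 / N"
      by auto
    then have "real N * \<bar>ordered_frac N \<alpha> (j i) - ordered_frac N \<alpha> (j k)\<bar> \<le> real N * (1 / N)"
      by (rule mult_left_mono) simp
    then show "\<bar>(real N *\<^sub>R (\<chi> i. ordered_frac N \<alpha> (j i))) $ i -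
        (real N *\<^sub>R (\<chi> i. ordered_frac N \<alpha> (j i))) $ k\<bar> \<le> 1"
      using \<open>N \<ge> 2\<close> by (simp add: abs_mult flip: right_diff_distrib)
  qed
  also have "\<dots> \<le> (\<Sum>j | strict_mono j \<and> range j \<subseteq> {1..N}.
      f (real N *\<^sub>R (\<chi> i::'m. ordered_frac N \<alpha> (j i))))"
  proof (rule sum_mono2)
    show "finite {j :: 'm \<Rightarrow> nat. strict_mono j \<and> range j \<subseteq> {1..N}}"
      by (rule finite_subset[of _ "PiE UNIV (\<lambda>_. {1..N})"]) (auto intro!: finite_PiE)
  qed (auto simp: J_def nonneg)
  finally show ?thesis
    by (simp add: correlation_def divide_right_mono)
qed

section \<open>Limits of sequences whose steps at least halve\<close>

lemma limit_dyadic: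
  fixes x d :: "nat \<Rightarrow> real"
  assumes step: "\<And>j. \<bar>x (Suc j) - x j\<bar> \<le> d j"
    and halve: "\<And>j. 2 * d (Suc j) \<le> d j"
  obtains \<alpha> where "\<And>j. \<bar>\<alpha> - x j\<bar> \<le> 2 * d j"
proof -
  \<comment> \<open>The subtracted term makes the induction close: the next step
    \<open>d (j + n)\<close> is paid for by \<open>2 * d (j + n) - 2 * d (j + n + 1)\<close>, thanks
    to halving.\<close>
  have telescope: "\<bar>x (j + n) - x j\<bar> \<le> 2 * d j - 2 * d (j + n)" for j n
  proof (induction n)
    case (Suc n)
    then show ?case using step[of "j + n"] halve[of "j + n"] by (simp add: abs_le_iff)
  qed simp
  have d_nonneg: "0 \<le> d j" for j using step[of j] by linarith
  have d_bound: "d j \<le> d 0 * (1 / 2) ^ j" for j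
  proof (induction j)
    case (Suc j)
    then show ?case using halve[of j] by simp
  qed simp
  have dist_bound: "\<bar>x (j + n) - x j\<bar> \<le> 2 * d j" for j n
    using telescope[of j n] d_nonneg[of "j + n"] by linarith
  have "(\<lambda>j. 2 * (d 0 * (1 / 2) ^ j)) \<longlonglongrightarrow> 2 * (d 0 * 0)"
    by (intro tendsto_intros LIMSEQ_power_zero) simp
  then have lim0: "(\<lambda>j. 2 * (d 0 * (1 / 2) ^ j)) \<longlonglongrightarrow> 0" by simp
  have "Cauchy x"
  proof (rule CauchyI')
    fix e :: real assume "e > 0"
    then obtain M where M: "2 * (d 0 * (1 / 2) ^ j) < e" if "j \<ge> M" for j
      using order_tendstoD(2)[OF lim0] by (auto simp: eventually_sequentially)
    have "dist (x m) (x n) < e" if "M \<le> m" "m < n" for m n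
      using dist_bound[of m "n - m"] d_bound[of m] M[OF that(1)] that(2)
      by (simp add: dist_real_def abs_minus_commute)
    then show "\<exists>M. \<forall>m\<ge>M. \<forall>n>m. dist (x m) (x n) < e" by blast
  qed
  then obtain \<alpha> where "x \<longlonglongrightarrow> \<alpha>"
    using Cauchy_convergent convergent_def by blast
  have "\<bar>\<alpha> - x j\<bar> \<le> 2 * d j" for j
  proof (rule tendsto_upperbound[OF _ always_eventually])
    show "(\<lambda>n. \<bar>x (j + n) - x j\<bar>) \<longlonglongrightarrow> \<bar>\<alpha> - x j\<bar>"
      using LIMSEQ_ignore_initial_segment[OF \<open>x \<longlonglongrightarrow> \<alpha>\<close>, of j]
      by (intro tendsto_intros) (simp add: add.commute)
  qed (use dist_bound in auto)
  with that show thesis by blast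
qed

section \<open>A continued fraction all of whose convergents have square denominators\<close>

fun root_denom :: "nat \<Rightarrow> nat" where
  "root_denom 0 = 1"
| "root_denom (Suc 0) = 2"
| "root_denom (Suc (Suc j)) = root_denom j + (root_denom (Suc j))\<^sup>2"

text \<open>The partial quotient is \<open>2 u + v\<^sup>2\<close> because \<open>(u + v\<^sup>2)\<^sup>2 = (2 u + v\<^sup>2) v\<^sup>2 + u\<^sup>2\<close>.\<close>

fun convergent_num :: "nat \<Rightarrow> int" where
  "convergent_num 0 = 0"
| "convergent_num (Suc 0) = 1"
| "convergent_num (Suc (Suc j)) =
     (2 * int (root_denom j) + (int (root_denom (Suc j)))\<^sup>2) * convergent_num (Suc j) + convergent_num j"

lemma root_denom_pos: "1 \<le> root_denom j"
  by (induction j rule: root_denom.induct) auto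

lemma root_denom_Suc: "root_denom j < root_denom (Suc j)"
proof (cases j)
  case (Suc i)
  have "root_denom (Suc i) \<le> (root_denom (Suc i))\<^sup>2"
    using root_denom_pos by (simp add: power2_eq_square)
  then show ?thesis using Suc root_denom_pos[of i] by simp
qed simp

lemma strict_mono_root_denom: "strict_mono root_denom"
  by (simp add: strict_mono_Suc_iff root_denom_Suc)

text \<open>The determinant of consecutive convergents, changing sign at each step. It yields their
  exact distance, and in particular that they differ.\<close>

lemma convergent_det:
  "convergent_num (Suc j) * (int (root_denom j))\<^sup>2 - convergent_num j * (int (root_denom (Suc j)))\<^sup>2
    = (- 1) ^ j"
proof (induction j)
  case (Suc j)
  define p p' where "p = convergent_num j" and "p' = convergent_num (Suc j)"
  define u v where "u = int (root_denom j)" and "v = int (root_denom (Suc j))"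
  have "((2 * u + v\<^sup>2) * p' + p) * v\<^sup>2 - p' * (u + v\<^sup>2)\<^sup>2 = - (p' * u\<^sup>2 - p * v\<^sup>2)"
    by (simp add: algebra_simps power2_eq_square)
  then show ?case using Suc by (simp add: p_def p'_def u_def v_def)
qed simp

lemma square_convergents_exist:
  obtains \<alpha> :: real where "\<alpha> \<notin> \<rat>"
    and "\<And>j. \<bar>(real (root_denom j))\<^sup>2 * \<alpha> - convergent_num j\<bar> \<le> 2 / (real (root_denom (Suc j)))\<^sup>2"
proof -
  define q where "q j = (real (root_denom j))\<^sup>2" for j
  define x where "x j = convergent_num j / q j" for j
  define d where "d j = 1 / (q j * q (Suc j))" for j
  have q_pos: "0 < q j" for j
    using root_denom_pos[of j] by (simp add: q_def)
  have diff: "\<bar>x (Suc j) - x j\<bar> = d j" for j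
  proof -
    have "real_of_int (convergent_num (Suc j) * (int (root_denom j))\<^sup>2
        - convergent_num j * (int (root_denom (Suc j)))\<^sup>2) = (- 1) ^ j"
      by (subst convergent_det) simp
    then have "convergent_num (Suc j) * q j - convergent_num j * q (Suc j) = (- 1) ^ j"
      by (simp add: q_def)
    moreover have "x (Suc j) - x j =
        (convergent_num (Suc j) * q j - convergent_num j * q (Suc j)) / (q j * q (Suc j))"
      using q_pos[of j] q_pos[of "Suc j"] by (simp add: x_def field_simps)
    ultimately show ?thesis
      using q_pos[of j] q_pos[of "Suc j"] by (simp add: d_def power_abs abs_mult)
  qed
  \<comment> \<open>After cancelling \<open>q (Suc j)\<close> this says that \<open>q\<close> at
    least doubles over two indices.\<close>
  have halve: "2 * d (Suc j) \<le> d j" for j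
  proof -
    have "2 * (root_denom j)\<^sup>2 \<le> (2 * root_denom j)\<^sup>2" by (simp add: power_mult_distrib)
    also have "\<dots> \<le> (root_denom (Suc (Suc j)))\<^sup>2"
    proof (rule power_mono)
      have "root_denom (Suc j) \<le> (root_denom (Suc j))\<^sup>2"
        using root_denom_pos by (simp add: power2_eq_square)
      then show "2 * root_denom j \<le> root_denom (Suc (Suc j))"
        using root_denom_Suc[of j] by simp
    qed simp
    finally have "real (2 * (root_denom j)\<^sup>2) \<le> real ((root_denom (Suc (Suc j)))\<^sup>2)"
      by (rule of_nat_mono)
    then have "2 * q j \<le> q (Suc (Suc j))" by (simp add: q_def)
    then show ?thesis
      using q_pos[of j] q_pos[of "Suc j"] q_pos[of "Suc (Suc j)"] by (simp add: d_def field_simps)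
  qed
  obtain \<alpha> where \<alpha>: "\<And>j. \<bar>\<alpha> - x j\<bar> \<le> 2 * d j"
    using limit_dyadic[of x d] diff halve by force
  have approx: "\<bar>q j * \<alpha> - convergent_num j\<bar> \<le> 2 / q (Suc j)" for j
  proof -
    have "\<bar>q j * \<alpha> - convergent_num j\<bar> = q j * \<bar>\<alpha> - x j\<bar>"
      using q_pos[of j] by (simp add: x_def abs_mult_pos field_simps flip: abs_mult_pos')
    also have "\<dots> \<le> q j * (2 * d j)"
      using \<alpha> q_pos[of j] by (intro mult_left_mono) auto
    also have "\<dots> = 2 / q (Suc j)"
      using q_pos[of j] by (simp add: d_def)
    finally show ?thesis .
  qed
  have "\<alpha> \<notin> \<rat>"
  proof
    assume "\<alpha> \<in> \<rat>"
    then obtain a b :: int where ab: "b > 0" "\<alpha> = a / b"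
      by (metis Rats_cases')
    \<comment> \<open>For a rational \<open>a / b\<close>, the number
      \<open>\<bar>q j * \<alpha> - convergent_num j\<bar> * b\<close> is an integer of size at most
      \<open>2 * b / q (Suc j)\<close>. Past index \<open>2 * b\<close> this is below 1, so every
      later convergent would equal \<alpha>.\<close>
    have eq: "\<alpha> = x j" if "j \<ge> nat (2 * b)" for j
    proof (rule ccontr)
      assume "\<alpha> \<noteq> x j"
      have "real_of_int (2 * b) \<le> real j" using that by linarith
      also have "\<dots> < real (root_denom (Suc j))"
        using strict_mono_imp_increasing[OF strict_mono_root_denom, of "Suc j"] by linarith
      also have "\<dots> \<le> q (Suc j)"
        using root_denom_pos[of "Suc j"] by (simp add: q_def power2_eq_square)
      finally have big: "2 * b < q (Suc j)" by simp
      have "\<bar>q j * \<alpha> - convergent_num j\<bar> * b = \<bar>real_of_int ((int (root_denom j))\<^sup>2 * a - convergent_num j * b)\<bar>"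
      proof -
        have "\<bar>q j * \<alpha> - convergent_num j\<bar> * b = \<bar>(q j * \<alpha> - convergent_num j) * b\<bar>"
          using ab(1) by (simp add: abs_mult)
        also have "(q j * \<alpha> - convergent_num j) * b = q j * a - convergent_num j * b"
          using ab by (simp add: algebra_simps)
        finally show ?thesis by (simp add: q_def)
      qed
      moreover have "(int (root_denom j))\<^sup>2 * a - convergent_num j * b \<noteq> 0"
      proof
        assume "(int (root_denom j))\<^sup>2 * a - convergent_num j * b = 0"
        then have "real_of_int ((int (root_denom j))\<^sup>2 * a - convergent_num j * b) = 0"
          by (simp only: of_int_0)
        then have "q j * a = convergent_num j * b" by (simp add: q_def)
        then have "\<alpha> = x j"
          using ab(1) q_pos[of j] by (simp add: x_def ab(2) frac_eq_eq mult.commute)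
        with \<open>\<alpha> \<noteq> x j\<close> show False ..
      qed
      ultimately have "1 \<le> \<bar>q j * \<alpha> - convergent_num j\<bar> * b" by linarith
      also have "\<dots> \<le> 2 / q (Suc j) * b"
        using approx[of j] ab by (intro mult_right_mono) auto
      finally show False using big q_pos[of "Suc j"] by (simp add: field_simps)
    qed
    have "x (Suc (nat (2 * b))) = x (nat (2 * b))"
      using eq[of "nat (2 * b)"] eq[of "Suc (nat (2 * b))"] by simp
    then have "d (nat (2 * b)) = 0"
      using diff[of "nat (2 * b)"] by simp
    then show False
      using q_pos[of "nat (2 * b)"] q_pos[of "Suc (nat (2 * b))"] by (simp add: d_def)
  qed
  with approx that show thesis by (auto simp: q_def)
qed

lemma strict_mono_bracket:
  fixes u :: "nat \<Rightarrow> nat"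
  assumes "strict_mono u" and "real (u 0) \<le> x"
  obtains j where "real (u j) \<le> x" "x < real (u (Suc j))"
proof -
  define k where "k = (LEAST k. x < real (u k))"
  have "x < real (nat \<lfloor>x\<rfloor> + 1)" using assms(2) by linarith
  also have "\<dots> \<le> real (u (nat \<lfloor>x\<rfloor> + 1))"
    using strict_mono_imp_increasing[OF assms(1)] of_nat_mono by blast
  finally have k: "x < real (u k)" unfolding k_def by (rule LeastI)
  with assms(2) obtain j where j: "k = Suc j" by (cases k) auto
  have "\<not> x < real (u j)" using not_less_Least[of j "\<lambda>k. x < real (u k)"] j k_def by simp
  with k j show thesis by (intro that[of j]) auto
qed

theorem correlation_quarter_power:
  "\<exists>\<alpha>. \<alpha> \<notin> \<rat> \<and>
     (\<forall>\<^sub>F N in sequentially. correlation N \<alpha> (spread_test :: real ^ 5 \<Rightarrow> real) \<ge> real N powr (1/4) / 20 ^ 5)"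
proof -
  obtain \<alpha> :: real where irr: "\<alpha> \<notin> \<rat>"
    and approx: "\<And>j. \<bar>(real (root_denom j))\<^sup>2 * \<alpha> - convergent_num j\<bar> \<le> 2 / (real (root_denom (Suc j)))\<^sup>2"
    using square_convergents_exist by blast
  have "correlation N \<alpha> (spread_test :: real ^ 5 \<Rightarrow> real) \<ge> real N powr (1/4) / 20 ^ 5"
    if N: "N \<ge> 20 ^ 4" for N
  proof -
    define r where "r = real N powr (1/4)"
    \<comment> \<open>With \<open>5 * L\<close> at most \<open>r / 2\<close>, the closeness bound is
      \<open>(r/2)^2 * 2 / r^6\<close>, within \<open>1 / r^4\<close>. Since \<open>r\<close> is at
      least 20, rounding down still leaves \<open>L\<close> at least \<open>r / 20\<close>.\<close>
    define L where "L = nat \<lfloor>r / 10\<rfloor>"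
    have r4: "r ^ 4 = N" and r3: "r ^ 3 = real N powr (3/4)"
      using N by (simp_all add: r_def powr_powr flip: powr_realpow)
    have "real (20 ^ 4) powr (1/4) \<le> r"
      unfolding r_def by (rule powr_mono2) (use N in auto)
    moreover have "real (20 ^ 4) powr (1/4) = 20"
      by (simp add: powr_powr flip: powr_realpow)
    ultimately have r: "r \<ge> 20" by simp
    have L: "real L \<le> r / 10" "r / 20 \<le> real L" using r by (simp_all add: L_def; linarith)+
    have "1 \<le> r ^ 3" using r by (intro one_le_power) auto
    \<comment> \<open>Both requirements meet at \<open>r^3\<close>: \<open>u\<close> at most
      \<open>r^3\<close> keeps the multiples below \<open>N = r^4\<close>, and the next root above
      \<open>r^3\<close> makes the approximation good enough.\<close>
    then obtain j where j: "real (root_denom j) \<le> r ^ 3" "r ^ 3 < real (root_denom (Suc j))"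
      using strict_mono_bracket[OF strict_mono_root_denom, of "r ^ 3"] by auto
    have L5: "5 * real L \<le> r / 2" using L by simp
    have "real (5 * L * root_denom j) \<le> r / 2 * r ^ 3"
      using j L5 r by (simp only: of_nat_mult of_nat_numeral) (intro mult_mono; simp)
    also have "\<dots> \<le> r ^ 4" using r by (simp add: power_numeral_reduce)
    finally have size: "5 * L * root_denom j \<le> N" unfolding r4 by (simp only: of_nat_le_iff)
    have "(real (5 * L))\<^sup>2 * \<bar>(real (root_denom j))\<^sup>2 * \<alpha> - convergent_num j\<bar>
        \<le> (r / 2)\<^sup>2 * (2 / (r ^ 3)\<^sup>2)"
    proof (rule mult_mono)
      show "(real (5 * L))\<^sup>2 \<le> (r / 2)\<^sup>2" using L5 by (intro power_mono) auto
      have "2 / (real (root_denom (Suc j)))\<^sup>2 \<le> 2 / (r ^ 3)\<^sup>2"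
        using j r by (intro divide_left_mono power_mono) auto
      with approx[of j] show "\<bar>(real (root_denom j))\<^sup>2 * \<alpha> - convergent_num j\<bar> \<le> 2 / (r ^ 3)\<^sup>2"
        by linarith
    qed auto
    also have "\<dots> \<le> 1 / r ^ 4"
      using r by (simp add: field_simps power_numeral_reduce)
    finally have close: "(real (5 * L))\<^sup>2 * \<bar>(real (root_denom j))\<^sup>2 * \<alpha> - convergent_num j\<bar> \<le> 1 / N"
      using r4 by simp
    have "r / 20 ^ 5 = (r / 20) ^ 5 / r ^ 4"
      using r by (simp add: field_simps power_numeral_reduce)
    also have "\<dots> \<le> real L ^ 5 / N"
      unfolding r4 using L r by (intro divide_right_mono power_mono) auto
    also have "\<dots> \<le> correlation N \<alpha> (spread_test :: real ^ 5 \<Rightarrow> real)"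
      using correlation_cluster[of "spread_test :: real ^ 5 \<Rightarrow> real" N "root_denom j" L \<alpha> "convergent_num j"]
        root_denom_pos[of j] size close N by (simp add: spread_test_nonneg spread_test_ge_1)
    finally show ?thesis by (simp add: r_def)
  qed
  then show ?thesis using irr by (auto simp: eventually_sequentially)
qed

section \<open>A lacunary series of small type\<close>

text \<open>The factor 6 makes this a square whose root is a cube, so that \<open>u^(1/3)\<close> is
  the integer \<open>10 ^ (2 ^ j)\<close>.\<close>

definition lac_denom :: "nat \<Rightarrow> nat" where
  "lac_denom j = 10 ^ (6 * 2 ^ j)"

text \<open>Numerators of the partial sums of \<open>1 / lac_denom i\<close> over the common
  denominator \<open>lac_denom j\<close>.\<close>

fun lac_num :: "nat \<Rightarrow> nat" where
  "lac_num 0 = 1"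
| "lac_num (Suc j) = lac_num j * lac_denom j + 1"

lemma lac_denom_Suc: "lac_denom (Suc j) = (lac_denom j)\<^sup>2"
  by (simp add: lac_denom_def power_mult[symmetric] mult.assoc mult.commute)

lemma lac_denom_ge: "10 ^ 6 \<le> lac_denom j"
  unfolding lac_denom_def by (rule power_increasing) auto

lemma lac_denom_gt: "j < lac_denom j"
proof -
  have "j < 2 ^ j" by (rule less_exp)
  also have "\<dots> \<le> 6 * 2 ^ j" by simp
  also have "\<dots> < 10 ^ (6 * 2 ^ j)" by (rule power_gt_expt) simp
  finally show ?thesis by (simp add: lac_denom_def)
qed

lemma coprime_lac: "coprime (lac_num j) (lac_denom j)"
proof (cases j)
  case (Suc i)
  have "coprime (lac_num i * lac_denom i + 1) (lac_denom i)"
    by (metis coprime_1_left coprime_iff_gcd_eq_1 gcd_add_mult mult.commute add.commute gcd.commute)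
  then show ?thesis by (simp add: Suc lac_denom_Suc)
qed simp

lemma lacunary_exists:
  obtains \<alpha> :: real where
    "\<And>j. \<bar>\<alpha> - lac_num j / lac_denom j\<bar> \<le> 2 / (real (lac_denom j))\<^sup>2"
proof -
  define d where "d j = 1 / (real (lac_denom j))\<^sup>2" for j
  define x where "x j = real (lac_num j) / lac_denom j" for j
  have big: "real (lac_denom j) \<ge> 10 ^ 6" for j
    using of_nat_mono[OF lac_denom_ge[of j], where 'a = real] by simp
  have "\<bar>x (Suc j) - x j\<bar> \<le> d j" for j
    using big[of j] by (simp add: x_def d_def lac_denom_Suc field_simps power2_eq_square)
  moreover have "2 * d (Suc j) \<le> d j" for j
  proof -
    have "2 \<le> (real (lac_denom j))\<^sup>2"
      using big[of j] power_mono[of "10 ^ 6" "real (lac_denom j)" 2] by simp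
    then show ?thesis
      using big[of j] by (simp add: d_def lac_denom_Suc field_simps power2_eq_square)
  qed
  ultimately obtain \<alpha> where "\<And>j. \<bar>\<alpha> - x j\<bar> \<le> 2 * d j"
    using limit_dyadic[of x d] by blast
  with that show thesis unfolding d_def x_def by simp blast
qed

text \<open>Two levels of the recursion make a numerator \<open>P = p Q + 1\<close> over \<open>Q\<^sup>2\<close> with
  \<open>p \<equiv> 1 (mod W)\<close>, \<open>Q = W\<^sup>2\<close>. A small value \<open>m = P q - a Q\<^sup>2\<close> forces \<open>q = t Q + m\<close> with
  \<open>t \<equiv> - m (mod W)\<close>, and then \<open>W\<close> divides \<open>m\<close>.\<close>

lemma no_small_linear_form:
  fixes W p0 p Q q a m :: int
  assumes W: "W \<ge> 4" and cop: "coprime p0 W"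
    and p: "p = p0 * W + 1" and Q: "Q = W\<^sup>2"
    and m: "m = (p * Q + 1) * q - a * Q\<^sup>2" and m_small: "2 * \<bar>m\<bar> < W"
    and q: "1 \<le> q" "4 * q \<le> W ^ 3"
  shows False
proof -
  define t where "t = a * Q - p * q"
  have q_eq: "q = t * Q + m"
    by (simp add: t_def m algebra_simps power2_eq_square)
  then have m_eq: "m = q - t * Q" by simp
  have "t + p * m = (a * Q - p * q) + p * (q - t * Q)"
    by (simp only: m_eq t_def)
  then have t_eq: "t + p * m = Q * (a - p * t)"
    by (simp add: algebra_simps)
  \<comment> \<open>\<open>q\<close> is at most \<open>W^3 / 4\<close> and \<open>Q = W^2\<close>,
    so the quotient \<open>t\<close> is about \<open>W / 4\<close> at most.\<close>
  have t_small: "2 * \<bar>t\<bar> < W"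
  proof -
    have "4 * (\<bar>t\<bar> * Q) = 4 * \<bar>q - m\<bar>"
      using q_eq W Q by (simp add: abs_mult)
    also have "\<dots> \<le> 4 * q + 4 * \<bar>m\<bar>"
      using abs_triangle_ineq4[of q m] q(1) by simp
    also have "\<dots> < W ^ 3 + 2 * W" using q m_small by linarith
    also have "\<dots> = W * (Q + 2)" by (simp add: Q algebra_simps power3_eq_cube power2_eq_square)
    also have "\<dots> \<le> W * (2 * Q)"
      using W self_le_power[of W 2] by (intro mult_left_mono) (simp_all add: Q)
    finally have "Q * (4 * \<bar>t\<bar>) < Q * (2 * W)" by (simp add: algebra_simps)
    then have "4 * \<bar>t\<bar> < 2 * W" using W Q by (simp add: mult_less_cancel_left_pos)
    then show ?thesis by simp
  qed
  \<comment> \<open>Reduction modulo \<open>W\<close>, where \<open>p\<close> is 1 and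
    \<open>Q\<close> is 0. As \<open>t\<close> and \<open>m\<close> are both below
    \<open>W / 2\<close> in size, the congruence becomes \<open>t = - m\<close>.\<close>
  have "t + m = W * (W * (a - p * t) - p0 * m)"
    using t_eq by (simp add: p Q algebra_simps power2_eq_square)
  then have "W dvd t + m" by simp
  moreover have "\<bar>t + m\<bar> < W" using t_small m_small by linarith
  ultimately have t: "t = - m"
    by (metis abs_ge_zero add_eq_0_iff2 dvd_imp_le_int linorder_not_less abs_of_nonneg add.commute W zero_le_numeral order_trans)
  \<comment> \<open>Substituting \<open>t = - m\<close> leaves \<open>(p - 1) * m\<close>, a
    multiple of \<open>Q = W^2\<close>; one factor \<open>W\<close> cancels because
    \<open>p - 1 = p0 * W\<close>.\<close>
  have "W * (p0 * m) = W * (W * (a - p * t))"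
    using t_eq t by (simp add: p Q algebra_simps power2_eq_square)
  then have "W dvd p0 * m" using W by simp
  then have "W dvd m" using cop by (simp add: coprime_commute coprime_dvd_mult_right_iff)
  then have "m = 0" using m_small W by (metis dvd_imp_le_int abs_of_nonneg linorder_not_less mult_2 abs_ge_zero add_increasing2 order_trans zero_le_numeral)
  with q_eq t q show False by simp
qed

text \<open>For \<open>4 * q\<close> up to \<open>Q\<close>, the fraction \<open>a / q\<close> is
  separated from the partial sum \<open>p / Q\<close>. For \<open>4 * q\<close> between
  \<open>Q\<close> and \<open>W^3\<close>, it is compared with the next partial sum: an error
  \<open>c * q powr (-5/2)\<close> would give a linear form of size below \<open>W / 2\<close>,
  which \<open>no_small_linear_form\<close> excludes.\<close>

theorem of_type_lacunary:
  assumes approx: "\<And>j. \<bar>\<alpha> - lac_num j / lac_denom j\<bar> \<le> 2 / (real (lac_denom j))\<^sup>2"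
  shows "of_type (5/2) \<alpha>"
proof -
  \<comment> \<open>\<open>10 ^ 12\<close> is \<open>lac_denom 1\<close>, which covers the case
    \<open>j = 0\<close>; the 2 matches the bound \<open>X / 2\<close> below.\<close>
  define c :: real where "c = 1 / (2 * 10 ^ 12)"
  have "c * q powr (- (5/2)) \<le> \<bar>\<alpha> - a / q\<bar>" if q: "q \<ge> 1" "coprime a q" for a q :: int
  proof (rule ccontr)
    assume "\<not> ?thesis"
    then have less: "\<bar>\<alpha> - a / q\<bar> < c * q powr (- (5/2))" by simp
    define j where "j = (LEAST j. 4 * q \<le> int (lac_denom j) ^ 3)"
    define W Q where "W = int (lac_denom j)" and "Q = int (lac_denom (Suc j))"
    define p0 p where "p0 = int (lac_num j)" and "p = int (lac_num (Suc j))"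
    have W: "W \<ge> 10 ^ 6" and QW: "Q = W\<^sup>2" and p: "p = p0 * W + 1"
      using lac_denom_ge[of j] by (simp_all add: W_def Q_def p_def p0_def lac_denom_Suc)
    have "4 * q \<le> int (lac_denom (nat (4 * q))) ^ 3"
    proof -
      have "4 * q \<le> int (lac_denom (nat (4 * q)))"
        using lac_denom_gt[of "nat (4 * q)"] by linarith
      also have "\<dots> \<le> int (lac_denom (nat (4 * q))) ^ 3"
        using lac_denom_ge[of "nat (4 * q)"] by (intro self_le_power) auto
      finally show ?thesis .
    qed
    then have qW: "4 * q \<le> W ^ 3"
      unfolding W_def j_def by (rule LeastI)
    have qpos: "real_of_int q \<ge> 1" using q by simp
    show False
    proof (cases "4 * q \<le> Q")
      case True
      have Q_le: "Q \<le> 10 ^ 12 * q powr (3/2)"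
      proof (cases j)
        case 0
        then have "real_of_int Q = 10 ^ 12" by (simp add: Q_def lac_denom_def)
        then show ?thesis using ge_one_powr_ge_zero[OF qpos, of "3/2"] by simp
      next
        case (Suc i)
        define V where "V = int (lac_denom i)"
        have V: "V \<ge> 1" using lac_denom_ge[of i] by (simp add: V_def)
        \<comment> \<open>Minimality of \<open>j\<close> bounds \<open>q\<close> from below in terms
          of \<open>Q = V^4\<close>. Rounding \<open>V^8\<close> up to the cube \<open>V^9\<close>
          gives the exponent 3/2.\<close>
        have "\<not> 4 * q \<le> V ^ 3"
          unfolding V_def using not_less_Least[of i "\<lambda>j. 4 * q \<le> int (lac_denom j) ^ 3"] Suc j_def
          by simp
        have "W = V\<^sup>2" by (simp add: W_def V_def Suc lac_denom_Suc)
        then have "Q\<^sup>2 = V ^ 8" by (simp add: QW flip: power_mult)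
        also have "\<dots> \<le> V ^ 9" using V by (intro power_increasing) auto
        also have "\<dots> = (V ^ 3) ^ 3" by (simp flip: power_mult)
        also have "\<dots> \<le> (4 * q) ^ 3"
          using V \<open>\<not> 4 * q \<le> V ^ 3\<close> by (intro power_mono) auto
        finally have "real_of_int (Q\<^sup>2) \<le> real_of_int ((4 * q) ^ 3)"
          by (simp only: of_int_le_iff)
        then have "(real_of_int Q)\<^sup>2 \<le> 64 * real_of_int q ^ 3" by (simp add: power_mult_distrib)
        also have "\<dots> = (8 * q powr (3/2))\<^sup>2"
          using qpos by (simp add: power_mult_distrib powr_power)
        finally have "Q \<le> 8 * q powr (3/2)"
          by (rule power2_le_imp_le) simp
        also have "\<dots> \<le> 10 ^ 12 * q powr (3/2)" by (intro mult_right_mono) auto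
        finally show ?thesis .
      qed
      have Qpos: "real_of_int Q > 0" using W QW by simp
      \<comment> \<open>Equality would force \<open>Q\<close> to divide \<open>q\<close>, which is
        too small.\<close>
      have ne: "a * Q - p * q \<noteq> 0"
      proof
        assume "a * Q - p * q = 0"
        then have "Q dvd p * q" by (metis dvd_triv_right eq_iff_diff_eq_0)
        moreover have "coprime Q p"
          using coprime_lac[of "Suc j"] by (simp add: Q_def p_def coprime_commute del: lac_num.simps)
        ultimately have "Q dvd q" by (simp add: coprime_dvd_mult_right_iff)
        then have "Q \<le> q" using q by (simp add: zdvd_imp_le)
        then show False using True q by simp
      qed
      define X where "X = 1 / (real_of_int q * real_of_int Q)"
      have "a / q - p / Q = of_int (a * Q - p * q) / (q * Q)"
        using q Qpos by (simp add: field_simps)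
      moreover have "1 \<le> \<bar>real_of_int (a * Q - p * q)\<bar>" using ne by linarith
      ultimately have "X \<le> \<bar>a / q - p / Q\<bar>"
        using q Qpos by (simp add: X_def divide_right_mono abs_mult)
      moreover have "\<bar>\<alpha> - p / Q\<bar> \<le> 2 / (real_of_int Q)\<^sup>2"
        using approx[of "Suc j"] by (simp add: p_def Q_def del: lac_num.simps)
      moreover have "2 / (real_of_int Q)\<^sup>2 \<le> X / 2"
      proof -
        have "4 * real_of_int q \<le> Q" using True by linarith
        then show ?thesis using qpos Qpos by (simp add: X_def field_simps power2_eq_square)
      qed
      ultimately have "X / 2 \<le> \<bar>\<alpha> - a / q\<bar>" by linarith
      moreover have "c * q powr (- (5/2)) \<le> X / 2"
      proof -
        have "q powr (5/2) = q * q powr (3/2)"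
          using qpos powr_add[of q 1 "3/2"] by simp
        then have "q * Q \<le> 10 ^ 12 * q powr (5/2)"
          using mult_left_mono[OF Q_le, of q] qpos by (simp add: ac_simps)
        then show ?thesis
          using qpos Qpos by (simp add: X_def c_def powr_minus field_simps)
      qed
      ultimately show False using less by linarith
    next
      case False
      \<comment> \<open>The numerator of the difference between the next partial sum,
        \<open>(p * Q + 1) / Q^2\<close>, and \<open>a / q\<close>.\<close>
      define m where "m = (p * Q + 1) * q - a * Q\<^sup>2"
      define w where "w = real_of_int W"
      have w: "w \<ge> 10 ^ 6" using W by (simp add: w_def)
      have Qw: "real_of_int Q = w\<^sup>2" by (simp add: QW w_def)
      have "w\<^sup>2 / 4 \<le> q" using False unfolding Qw[symmetric] by linarith
      then have "q powr (- (3/2)) \<le> (w\<^sup>2 / 4) powr (- (3/2))"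
        using w by (intro powr_mono2') auto
      also have "\<dots> = 8 / w ^ 3"
      proof -
        have "(w\<^sup>2 / 4) powr (3/2) = ((w / 2) powr 2) powr (3/2)"
          using w by (simp add: power_divide)
        also have "\<dots> = (w / 2) ^ 3"
          using w powr_powr[of "w / 2" 2 "3/2"] powr_numeral[of "w / 2" "num.Bit1 num.One"] by simp
        finally show ?thesis by (simp only: powr_minus power_divide inverse_divide) simp
      qed
      finally have q_powr: "q powr (- (3/2)) \<le> 8 / w ^ 3" .
      define y where "y = (p * Q + 1) / (real_of_int Q)\<^sup>2"
      have "\<bar>\<alpha> - y\<bar> \<le> 2 / w ^ 8"
        using approx[of "Suc (Suc j)"] Qw
        by (simp add: y_def p_def Q_def lac_denom_Suc[of "Suc j"] algebra_simps flip: power_mult)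
      moreover have "\<bar>y - a / q\<bar>
          \<le> \<bar>\<alpha> - y\<bar> + \<bar>\<alpha> - a / q\<bar>" by linarith
      ultimately have "\<bar>y - a / q\<bar> \<le> 2 / w ^ 8 + c * q powr (- (5/2))"
        using less by linarith
      moreover have "m = (q * (real_of_int Q)\<^sup>2) * (y - a / q)"
        using qpos w Qw by (simp add: y_def m_def field_simps)
      ultimately have "\<bar>real_of_int m\<bar> \<le> (q * (real_of_int Q)\<^sup>2) * (2 / w ^ 8 + c * q powr (- (5/2)))"
        using qpos by (simp add: abs_mult mult_left_mono)
      also have "\<dots> = 2 * q / w ^ 4 + c * (w ^ 4 * q powr (- (3/2)))"
      proof -
        have "q powr (- (3/2)) = q * q powr (- (5/2))"
          using qpos powr_add[of q 1 "- (5/2)"] by simp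
        then show ?thesis using w by (simp add: Qw field_simps power_numeral_reduce)
      qed
      \<comment> \<open>The first term is the tail of the series, the second the assumed
        approximation, bounded using \<open>q\<close> at least \<open>w^2 / 4\<close>.\<close>
      also have "\<dots> \<le> 1 / 2 + w / 4"
      proof (rule add_mono)
        have "4 * real_of_int q \<le> w ^ 3"
          using qW unfolding w_def by (metis of_int_le_iff of_int_mult of_int_numeral of_int_power)
        also have "\<dots> \<le> w ^ 4" using w by (intro power_increasing) auto
        finally show "2 * q / w ^ 4 \<le> 1 / 2" using w by (simp add: field_simps)
        have "c * (w ^ 4 * q powr (- (3/2))) \<le> c * (w ^ 4 * (8 / w ^ 3))"
          using q_powr w by (intro mult_left_mono) (auto simp: c_def)
        also have "\<dots> \<le> w / 4" using w by (simp add: c_def power_numeral_reduce)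
        finally show "c * (w ^ 4 * q powr (- (3/2))) \<le> w / 4" .
      qed
      finally have "2 * \<bar>real_of_int m\<bar> < w" using w by simp
      then have "2 * \<bar>m\<bar> < W" unfolding w_def by linarith
      moreover have "coprime p0 W" using coprime_lac[of j] by (simp add: p0_def W_def)
      ultimately show False
        using no_small_linear_form[of W p0 p Q m q a] W p QW m_def q(1) qW by simp
    qed
  qed
  moreover have "c > 0" by (simp add: c_def)
  ultimately show ?thesis unfolding of_type_def by blast
qed

lemma of_type_mono:
  assumes "of_type K \<alpha>" "K \<le> K'"
  shows "of_type K' \<alpha>"
proof -
  obtain c where c: "c > 0" "\<And>a q :: int. q \<ge> 1 \<Longrightarrow> coprime a q \<Longrightarrow> c * q powr (- K) \<le> \<bar>\<alpha> - a / q\<bar>"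
    using assms(1) unfolding of_type_def by blast
  have "c * q powr (- K') \<le> \<bar>\<alpha> - a / q\<bar>" if q: "q \<ge> 1" "coprime a q" for a q :: int
  proof -
    have "c * q powr (- K') \<le> c * q powr (- K)"
      using c(1) q assms(2) by (intro mult_left_mono powr_mono) auto
    with c(2)[OF q] show ?thesis by linarith
  qed
  with c(1) show ?thesis unfolding of_type_def by blast
qed

text \<open>With \<open>u = 1000 * L^3\<close> the \<open>5 * L\<close> multiples of
  \<open>u\<close> exactly reach \<open>N = 5000 * L^4\<close>, and \<open>L^5 / N\<close> is
  \<open>L / 5000\<close>. The \<open>- 1\<close> in the exponent makes
  \<open>lac_denom j = (10 * L)^6\<close>; this factor 10 absorbs the constants in the closeness
  condition.\<close>

lemma correlation_lacunary:
  assumes approx: "\<And>j. \<bar>\<alpha> - lac_num j / lac_denom j\<bar> \<le> 2 / (real (lac_denom j))\<^sup>2"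
  defines "L \<equiv> (\<lambda>j. 10 ^ (2 ^ j - 1) :: nat)"
  shows "real (L j) / 5000 \<le> correlation (5000 * L j ^ 4) \<alpha> (spread_test :: real ^ 5 \<Rightarrow> real)"
proof -
  define l where "l = real (L j)"
  have l: "l \<ge> 1" by (simp add: l_def L_def)
  have "10 * L j = 10 ^ (2 ^ j)"
    by (simp add: L_def flip: power_Suc)
  then have denom: "lac_denom j = (1000 * L j ^ 3)\<^sup>2"
  proof -
    have "lac_denom j = (10 * L j) ^ 6"
      unfolding \<open>10 * L j = 10 ^ (2 ^ j)\<close> lac_denom_def by (simp add: mult.commute flip: power_mult)
    then show ?thesis by (simp add: power_mult_distrib flip: power_mult)
  qed
  have real_denom: "real (lac_denom j) = 1000000 * l ^ 6"
    by (simp add: denom l_def power_mult_distrib flip: power_mult)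
  have "\<bar>(real (1000 * L j ^ 3))\<^sup>2 * \<alpha> - lac_num j\<bar> = lac_denom j * \<bar>\<alpha> - lac_num j / lac_denom j\<bar>"
    using l by (simp add: denom l_def field_simps flip: abs_mult_pos')
  also have "\<dots> \<le> lac_denom j * (2 / (real (lac_denom j))\<^sup>2)"
    using approx by (intro mult_left_mono) auto
  also have "\<dots> = 2 / lac_denom j"
    by (simp add: power2_eq_square)
  also have "\<dots> = 2 / (1000000 * l ^ 6)"
    by (simp only: real_denom)
  finally have "(real (5 * L j))\<^sup>2 * \<bar>(real (1000 * L j ^ 3))\<^sup>2 * \<alpha> - lac_num j\<bar>
      \<le> (5 * l)\<^sup>2 * (2 / (1000000 * l ^ 6))"
    unfolding of_nat_mult l_def[symmetric] of_nat_numeral by (rule mult_left_mono) simp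
  also have "\<dots> \<le> 1 / real (5000 * L j ^ 4)"
    using l by (simp add: l_def[symmetric] field_simps power_numeral_reduce)
  finally have "real (L j) ^ 5 / real (5000 * L j ^ 4) \<le> correlation (5000 * L j ^ 4) \<alpha> (spread_test :: real ^ 5 \<Rightarrow> real)"
    using correlation_cluster[of "spread_test :: real ^ 5 \<Rightarrow> real" "5000 * L j ^ 4" "1000 * L j ^ 3" "L j" \<alpha> "int (lac_num j)"]
      l by (simp add: spread_test_nonneg spread_test_ge_1 l_def power_numeral_reduce)
  then show ?thesis using l by (simp add: l_def power_numeral_reduce)
qed

theorem theorem2:
  "(\<exists>\<alpha> (f :: real ^ 5 \<Rightarrow> real). \<alpha> \<notin> \<rat> \<and> admissible f \<and>
      (\<exists>c>0. \<forall>\<^sub>F N in sequentially.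
         correlation N \<alpha> f \<ge> c * (real N powr (1/4) * ln (real N) powi (-5)))) \<and>
   (\<forall>\<sigma>::real. \<sigma> > 23/8 \<longrightarrow>
      (\<exists>\<alpha> (f :: real ^ 5 \<Rightarrow> real). of_type \<sigma> \<alpha> \<and> admissible f \<and>
         limsup (\<lambda>N. ereal (correlation N \<alpha> f)) = \<infinity>))"
proof (intro conjI allI impI)
  obtain \<alpha> where irr: "\<alpha> \<notin> \<rat>" and lower: "\<forall>\<^sub>F N in sequentially.
      correlation N \<alpha> (spread_test :: real ^ 5 \<Rightarrow> real) \<ge> real N powr (1/4) / 20 ^ 5"
    using correlation_quarter_power by blast
  have "\<forall>\<^sub>F N in sequentially. correlation N \<alpha> (spread_test :: real ^ 5 \<Rightarrow> real) \<ge>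
      1 / 20 ^ 5 * (real N powr (1/4) * ln (real N) powi (-5))"
    using lower eventually_ge_at_top[of 3]
  proof eventually_elim
    case (elim N)
    \<comment> \<open>From \<open>N = 3\<close> on the logarithmic factor is at most 1, so the bound
      without logarithms suffices.\<close>
    have "1 \<le> ln (real N)"
      using elim(2) exp_le by (subst ln_ge_iff) auto
    then have "ln (real N) powi (-5) \<le> 1"
      by (simp add: power_int_minus one_le_power inverse_le_1_iff)
    then have "real N powr (1/4) * ln (real N) powi (-5) \<le> real N powr (1/4)"
      by (intro mult_left_le) auto
    with elim(1) show ?case by simp
  qed
  then show "\<exists>\<alpha> (f :: real ^ 5 \<Rightarrow> real). \<alpha> \<notin> \<rat> \<and> admissible f \<and>
      (\<exists>c>0. \<forall>\<^sub>F N in sequentially.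
         correlation N \<alpha> f \<ge> c * (real N powr (1/4) * ln (real N) powi (-5)))"
    using irr admissible_spread_test
    by (intro exI[of _ \<alpha>] exI[of _ spread_test] conjI exI[of _ "1 / 20 ^ 5"]) auto
next
  fix \<sigma> :: real assume "\<sigma> > 23/8"
  obtain \<alpha> :: real where approx:
    "\<And>j. \<bar>\<alpha> - lac_num j / lac_denom j\<bar> \<le> 2 / (real (lac_denom j))\<^sup>2"
    using lacunary_exists by blast
  define L :: "nat \<Rightarrow> nat" where "L j = 10 ^ (2 ^ j - 1)" for j
  let ?R = "\<lambda>N. correlation N \<alpha> (spread_test :: real ^ 5 \<Rightarrow> real)"
  have L_ge: "j \<le> L j" for j
  proof -
    have "j \<le> 2 ^ j - 1" using less_exp[of j] by linarith
    also have "\<dots> < L j" unfolding L_def by (rule power_gt_expt) simp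
    finally show ?thesis by simp
  qed
  have "limsup (\<lambda>N. ereal (?R N)) = \<infinity>"
  proof (rule ccontr)
    assume "limsup (\<lambda>N. ereal (?R N)) \<noteq> \<infinity>"
    then obtain b :: nat where "limsup (\<lambda>N. ereal (?R N)) < ereal b"
      using less_PInf_Ex_of_nat by blast
    then have "\<forall>\<^sub>F N in sequentially. ereal (?R N) < ereal b" by (rule Limsup_lessD)
    then obtain M where M: "?R N < b" if "N \<ge> M" for N
      by (auto simp: eventually_sequentially)
    \<comment> \<open>\<open>M\<close> makes \<open>N\<close> large enough for the assumed bound,
      \<open>5000 * b\<close> makes \<open>L j / 5000\<close> at least \<open>b\<close>.\<close>
    define j where "j = max M (5000 * b)"
    have "j \<le> 5000 * L j ^ 4"
      using L_ge[of j] self_le_power[of "L j" 4] by (simp add: L_def)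
    then have "?R (5000 * L j ^ 4) < b" by (intro M) (simp add: j_def)
    moreover have "real (L j) / 5000 \<le> ?R (5000 * L j ^ 4)"
      using correlation_lacunary[OF approx, of j] by (simp add: L_def)
    moreover have "real (5000 * b) \<le> real (L j)"
      using L_ge[of j] unfolding j_def by (intro of_nat_mono) linarith
    ultimately show False by linarith
  qed
  moreover have "of_type \<sigma> \<alpha>"
    using of_type_mono[OF of_type_lacunary[OF approx]] \<open>\<sigma> > 23/8\<close> by simp
  ultimately show "\<exists>\<alpha> (f :: real ^ 5 \<Rightarrow> real). of_type \<sigma> \<alpha> \<and> admissible f \<and>
      limsup (\<lambda>N. ereal (correlation N \<alpha> f)) = \<infinity>"
    using admissible_spread_test by blast
qed

end
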